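(* Let $M<\infty$ be a constant and let $r_1,r_2:\mathbb{N}\to\mathbb{Z}$ be functions with $1\le r_1(i),r_2(i)\le M$ for all $i\in\mathbb{N}=\{1,2,\dots\}$. For $n\ge 1$ and $1\le i\le n$ set $m_{1,n}(i)=\min\{n-i,r_1(i)\}$ and $m_{2,n}(i)=\min\{i-1,r_2(i)\}$. For each $i$ let relations $\triangle_j=\triangle_j^{(i)}\in\{<,>\}$, $-r_2(i)\le j\le r_1(i)-1$, be given. For $\tau_n\in S_n$ and $1\le i\le n$ let $\chi_i(\tau_n)\in\{0,1\}$ be the indicator $$\chi_i(\tau_n)=\mathbf{1}\big(\tau_n(i-m_{2,n}(i))\,\triangle_{-m_{2,n}(i)}\cdots\triangle_{-2}\,\tau_n(i-1)\,\triangle_{-1}\,\tau_n(i)\,\triangle_0\,\tau_n(i+1)\,\triangle_1\cdots\triangle_{m_{1,n}(i)-1}\,\tau_n(i+m_{1,n}(i))\big),$$ that is, $\chi_i(\tau_n)=1$ if and only if $\tau_n(i+j)\,\triangle_j\,\tau_n(i+j+1)$ for every integer $j$ with $-m_{2,n}(i)\le j\le m_{1,n}(i)-1$. Let $$Y(\tau_n)=\sum_{i=1}^n\chi_i(\tau_n).$$ Let $\rho_n$ and $\pi_n$ be random permutations in $S_n$ with the inverse-unfair and the uniform distribution, respectively. Then for every integer $k\ge 1$, $$\frac{\mathbb{E}\left[(Y(\rho_n))^k\right]}{\mathbb{E}\left[(Y(\pi_n))^k\right]}\longrightarrow 1\quad\text{as } n\to\infty.$$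
   Context: $S_n$ is the symmetric group on $\{1,\dots,n\}$. Inverse-unfair distribution: let $\{X^{(i)}_j : 1\le i\le n,\ 1\le j\le i\}$ be independent random variables, each uniform on $(0,1)$, and set $Z_i=\max\{X^{(i)}_1,\dots,X^{(i)}_i\}$ for $i=1,\dots,n$. Let $R_i$ be the rank of $Z_i$ among $Z_1,\dots,Z_n$ (rank $1$ is the smallest value; ties have probability zero). The inverse-unfair permutation is $\rho_n=(R_1,\dots,R_n)$, i.e. $\rho_n(i)=R_i$. *)

theory Defs
  imports "HOL-Probability.Probability" "HOL-Combinatorics.Permutations"
begin

text \<open>A permutation in \<open>S\<^sub>n\<close> is a function \<open>nat \<Rightarrow> nat\<close> satisfying \<open>permutes {1..n}\<close>;
  in particular it is the identity outside \<open>{1..n}\<close>.\<close>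

definition unfair_index :: "nat \<Rightarrow> (nat \<times> nat) set" where
  "unfair_index n = (SIGMA i:{1..n}. {1..i})"

definition unfair_max :: "(nat \<times> nat \<Rightarrow> real) \<Rightarrow> nat \<Rightarrow> real" where
  "unfair_max x i = Max ((\<lambda>j. x (i, j)) ` {1..i})"

text \<open>Rank 1 is the smallest value. If there are ties among \<open>z 1, \<dots>, z n\<close>, the result need
  not be a permutation; below this happens with probability zero only.\<close>

definition rank_perm :: "nat \<Rightarrow> (nat \<Rightarrow> real) \<Rightarrow> nat \<Rightarrow> nat" where
  "rank_perm n z i = (if i \<in> {1..n} then card {l \<in> {1..n}. z l \<le> z i} else i)"

text \<open>The law of \<open>\<rho>\<^sub>n\<close>, with the variables \<open>X\<^sup>(\<^sup>i\<^sup>)\<^sub>j\<close> realised as the coordinates of a product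
  space. The lemma \<open>inverse_unfair_of_indep_vars\<close> below shows that any other independent
  family of uniform variables gives the same law.\<close>

definition inverse_unfair :: "nat \<Rightarrow> (nat \<Rightarrow> nat) measure" where
  "inverse_unfair n =
     distr (PiM (unfair_index n) (\<lambda>_. uniform_measure lborel {0<..<1}))
       (count_space UNIV) (\<lambda>x. rank_perm n (unfair_max x))"

definition uniform_perm :: "nat \<Rightarrow> (nat \<Rightarrow> nat) measure" where
  "uniform_perm n = measure_pmf (pmf_of_set {p. p permutes {1..n}})"

definition m1 :: "(nat \<Rightarrow> int) \<Rightarrow> nat \<Rightarrow> nat \<Rightarrow> int" where
  "m1 r1 n i = min (int n - int i) (r1 i)"

definition m2 :: "(nat \<Rightarrow> int) \<Rightarrow> nat \<Rightarrow> nat \<Rightarrow> int" where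
  "m2 r2 n i = min (int i - 1) (r2 i)"

text \<open>For \<open>1 \<le> i \<le> n\<close> and \<open>j\<close> in the range below, \<open>1 \<le> i + j\<close> and \<open>i + j + 1 \<le> n\<close>, so
  \<open>nat\<close> never truncates.\<close>

definition chi ::
  "(nat \<Rightarrow> int) \<Rightarrow> (nat \<Rightarrow> int) \<Rightarrow> (nat \<Rightarrow> int \<Rightarrow> nat \<Rightarrow> nat \<Rightarrow> bool) \<Rightarrow> nat \<Rightarrow> nat \<Rightarrow> (nat \<Rightarrow> nat) \<Rightarrow> real"
  where
  "chi r1 r2 tri n i \<tau> =
     of_bool (\<forall>j\<in>{- m2 r2 n i .. m1 r1 n i - 1}.
       tri i j (\<tau> (nat (int i + j))) (\<tau> (nat (int i + j + 1))))"

definition Y ::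
  "(nat \<Rightarrow> int) \<Rightarrow> (nat \<Rightarrow> int) \<Rightarrow> (nat \<Rightarrow> int \<Rightarrow> nat \<Rightarrow> nat \<Rightarrow> bool) \<Rightarrow> nat \<Rightarrow> (nat \<Rightarrow> nat) \<Rightarrow> real"
  where
  "Y r1 r2 tri n \<tau> = (\<Sum>i=1..n. chi r1 r2 tri n i \<tau>)"

lemma finite_unfair_index: "finite (unfair_index n)"
  by (simp add: unfair_index_def)

lemma measurable_unfair_max:
  assumes "i \<in> {1..n}"
  shows "(\<lambda>x. unfair_max x i) \<in> borel_measurable (PiM (unfair_index n) (\<lambda>_. borel))"
  unfolding unfair_max_def
proof (rule borel_measurable_Max)
  show "(\<lambda>x. x (i, j)) \<in> borel_measurable (PiM (unfair_index n) (\<lambda>_. borel))"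
    if "j \<in> {1..i}" for j
    using that assms by (intro measurable_component_singleton) (auto simp: unfair_index_def)
qed simp

lemma measurable_rank_perm_unfair_max:
  "(\<lambda>x. rank_perm n (unfair_max x)) \<in> PiM (unfair_index n) (\<lambda>_. borel) \<rightarrow>\<^sub>M count_space UNIV"
proof -
  let ?N = "PiM (unfair_index n) (\<lambda>_. borel :: real measure)"
  define C where "C x = {(l, i) \<in> {1..n} \<times> {1..n}. unfair_max x l \<le> unfair_max x i}" for x
  define g where "g c i = (if i \<in> {1..n} then card {l. (l, i) \<in> c} else i)"
    for c :: "(nat \<times> nat) set" and i
  have eq: "(\<lambda>x. rank_perm n (unfair_max x)) = g \<circ> C"
    by (auto simp: fun_eq_iff rank_perm_def g_def C_def intro!: arg_cong[where f = card])
  have "C \<in> ?N \<rightarrow>\<^sub>M count_space (Pow ({1..n} \<times> {1..n}))"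
  proof (rule measurable_count_space_eq2[THEN iffD2])
    show "finite (Pow ({1..n} \<times> {1..n}))"
      by simp
    show "C \<in> space ?N \<rightarrow> Pow ({1..n} \<times> {1..n}) \<and>
      (\<forall>c\<in>Pow ({1..n} \<times> {1..n}). C -` {c} \<inter> space ?N \<in> sets ?N)"
    proof (intro conjI ballI)
      fix c assume c: "c \<in> Pow ({1..n} \<times> {1..n})"
      have "C -` {c} \<inter> space ?N = {x \<in> space ?N. \<forall>p\<in>{1..n} \<times> {1..n}.
        (unfair_max x (fst p) \<le> unfair_max x (snd p)) = (p \<in> c)}"
        using c by (fastforce simp: C_def set_eq_iff)
      also have "\<dots> \<in> sets ?N"
      proof (rule sets.sets_Collect_finite_All)
        fix p assume p: "p \<in> {1..n} \<times> {1..n}"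
        have "{x \<in> space ?N. unfair_max x (fst p) \<le> unfair_max x (snd p)} \<in> sets ?N"
          using p by (intro borel_measurable_le measurable_unfair_max) auto
        then show "{x \<in> space ?N. (unfair_max x (fst p) \<le> unfair_max x (snd p)) = (p \<in> c)} \<in> sets ?N"
          by (cases "p \<in> c") (auto dest: sets.sets_Collect_neg)
      qed simp
      finally show "C -` {c} \<inter> space ?N \<in> sets ?N" .
    qed (auto simp: C_def)
  qed
  then have "g \<circ> C \<in> ?N \<rightarrow>\<^sub>M count_space UNIV"
    by (rule measurable_comp) simp
  then show ?thesis
    unfolding eq .
qed

lemma (in prob_space) inverse_unfair_of_indep_vars:
  assumes "n \<ge> 1"
    and indep: "indep_vars (\<lambda>_. borel) X (unfair_index n)"
    and unif: "\<And>p. p \<in> unfair_index n \<Longrightarrow> distr M borel (X p) = uniform_measure lborel {0<..<1::real}"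
  shows "distr M (count_space UNIV) (\<lambda>\<omega>. rank_perm n (unfair_max (\<lambda>p. X p \<omega>))) = inverse_unfair n"
proof -
  let ?I = "unfair_index n"
  have "(1, 1) \<in> ?I"
    using \<open>n \<ge> 1\<close> by (simp add: unfair_index_def)
  then have ne: "?I \<noteq> {}"
    by blast
  have rv: "\<And>p. p \<in> ?I \<Longrightarrow> random_variable borel (X p)"
    using indep by (auto simp: indep_vars_def)
  have m: "(\<lambda>\<omega>. \<lambda>p\<in>?I. X p \<omega>) \<in> M \<rightarrow>\<^sub>M PiM ?I (\<lambda>_. borel)"
    using rv by (intro measurable_restrict) auto
  have "distr M (PiM ?I (\<lambda>_. borel)) (\<lambda>\<omega>. \<lambda>p\<in>?I. X p \<omega>) =
    PiM ?I (\<lambda>p. distr M borel (X p))"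
    using indep indep_vars_iff_distr_eq_PiM'[where I = ?I and X = X and M' = "\<lambda>_. borel"] ne rv
    by simp
  also have "\<dots> = PiM ?I (\<lambda>_. uniform_measure lborel {0<..<1})"
    using unif by (intro PiM_cong) auto
  finally have "inverse_unfair n = distr (distr M (PiM ?I (\<lambda>_. borel)) (\<lambda>\<omega>. \<lambda>p\<in>?I. X p \<omega>))
      (count_space UNIV) (\<lambda>x. rank_perm n (unfair_max x))"
    by (simp add: inverse_unfair_def)
  also have "\<dots> = distr M (count_space UNIV)
      ((\<lambda>x. rank_perm n (unfair_max x)) \<circ> (\<lambda>\<omega>. \<lambda>p\<in>?I. X p \<omega>))"
    by (rule distr_distr[OF measurable_rank_perm_unfair_max m])
  also have "(\<lambda>x. rank_perm n (unfair_max x)) \<circ> (\<lambda>\<omega>. \<lambda>p\<in>?I. X p \<omega>) =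
      (\<lambda>\<omega>. rank_perm n (unfair_max (\<lambda>p. X p \<omega>)))"
  proof -
    have "unfair_max (\<lambda>p\<in>?I. X p \<omega>) i = unfair_max (\<lambda>p. X p \<omega>) i" if "i \<in> {1..n}" for i \<omega>
      unfolding unfair_max_def using that
      by (intro arg_cong[where f = Max] image_cong) (auto simp: unfair_index_def)
    then show ?thesis
      by (auto simp: fun_eq_iff rank_perm_def intro!: arg_cong[where f = card])
  qed
  finally show ?thesis
    by simp
qed

end

theory Submission
  imports Defs
begin

text \<open>The variable \<open>U\<^sub>i = Z\<^sub>i\<^sup>i\<close> is uniform on \<open>(0,1)\<close>, so both permutations can be built from one i.i.d.
  uniform sequence: \<open>\<pi>\<^sub>n\<close> ranks the \<open>U\<^sub>i\<close> and \<open>\<rho>\<^sub>n\<close> ranks their \<open>i\<close>-th roots. In this coupling the two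
  permutations order \<open>i\<close> and \<open>i + 1\<close> differently only if \<open>Z\<^sub>i\<^sup>i\<^sup>+\<^sup>1 \<le> U\<^sub>i\<^sub>+\<^sub>1 \<le> Z\<^sub>i\<^sup>i\<close>, an event of
  probability at most \<open>1 / (i + 1)\<close>. As the windows are bounded, \<open>Y(\<rho>\<^sub>n)\<close> and \<open>Y(\<pi>\<^sub>n)\<close> differ by
  \<open>O(log n)\<close> in mean and their \<open>k\<close>-th moments by \<open>O(n\<^sup>k\<^sup>-\<^sup>1 log n)\<close>, whereas the \<open>k\<close>-th moment of \<open>Y(\<pi>\<^sub>n)\<close>
  is at least of order \<open>n\<^sup>k\<close>.\<close>

subsection \<open>Independent uniform variables\<close>

definition unif :: "real measure" where
  "unif = uniform_measure lborel {0<..<1}"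

lemma sets_unif [simp, measurable_cong]: "sets unif = sets borel"
  by (simp add: unif_def)

lemma space_unif [simp]: "space unif = UNIV"
  by (simp add: unif_def)

lemma prob_space_unif: "prob_space unif"
  unfolding unif_def by (rule prob_space_uniform_measure) auto

interpretation unif: prob_space unif
  by (rule prob_space_unif)

lemma product_prob_space_unif: "product_prob_space (\<lambda>_. unif)"
  by (rule product_prob_spaceI) (rule prob_space_unif)

lemma emeasure_unif:
  "A \<in> sets borel \<Longrightarrow> emeasure unif A = emeasure lborel ({0<..<1} \<inter> A)"
  by (simp add: unif_def emeasure_uniform_measure divide_ennreal_def)

lemma AE_unif: "AE x in unif. x \<in> {0<..<1}"
  unfolding unif_def by (rule AE_uniform_measureI) auto

lemma AE_PiM_unif:
  assumes "finite I"
  shows "AE u in PiM I (\<lambda>_. unif). \<forall>i\<in>I. u i \<in> {0<..<1}"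
proof -
  have "AE u in PiM I (\<lambda>_. unif). u i \<in> {0<..<1}" if "i \<in> I" for i
    using that by (intro AE_PiM_component[where P = "\<lambda>y. y \<in> {0<..<1}"] prob_space_unif AE_unif)
  with assms show ?thesis
    by (subst AE_finite_all) auto
qed

lemma integrable_indicator_PiM_unif:
  assumes "A \<in> sets (PiM I (\<lambda>_. unif))"
  shows "integrable (PiM I (\<lambda>_. unif)) (\<lambda>u. indicator A u :: real)"
proof -
  interpret prob_space "PiM I (\<lambda>_. unif)"
    by (intro prob_space_PiM prob_space_unif)
  show ?thesis
    using assms by (intro integrable_real_indicator) (auto simp: emeasure_eq_measure)
qed

text \<open>The coordinate map is the identity on the product space, so the joint law of the
  coordinates is \<open>PiM I M\<close>, the product of their marginals. This is the criterion for
  independence.\<close>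

lemma indep_vars_PiM_coordinates:
  assumes "I \<noteq> {}" and M: "\<And>i. prob_space (M i)"
  shows "prob_space.indep_vars (PiM I M) M (\<lambda>i x. x i) I"
proof -
  interpret prob_space "PiM I M"
    by (intro prob_space_PiM M)
  have "distr (PiM I M) (PiM I M) (\<lambda>x. \<lambda>i\<in>I. x i) = distr (PiM I M) (PiM I M) (\<lambda>x. x)"
    by (rule distr_cong) (auto simp: space_PiM)
  moreover have "PiM I (\<lambda>i. distr (PiM I M) (M i) (\<lambda>x. x i)) = PiM I M"
    by (intro PiM_cong distr_PiM_component M refl)
  ultimately show ?thesis
    using assms by (subst indep_vars_iff_distr_eq_PiM') (auto simp: distr_id2)
qed

text \<open>Two distinct coordinates are independent with law \<open>unif\<close>, so by Fubini the
  probability is an average of slice measures, taken over points of (0,1). Serves for ties, with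
  bound 0, and for the order changes of the coupling.\<close>

lemma emeasure_PiM_unif_pair_le:
  assumes ij: "i \<in> I" "j \<in> I" "i \<noteq> j"
    and S: "S \<in> sets (borel \<Otimes>\<^sub>M borel)"
    and le: "\<And>x. 0 < x \<Longrightarrow> x < 1 \<Longrightarrow> emeasure unif (Pair x -` S) \<le> c"
  shows "emeasure (PiM I (\<lambda>_. unif)) {u \<in> space (PiM I (\<lambda>_. unif)). (u i, u j) \<in> S} \<le> c"
proof -
  let ?P = "PiM I (\<lambda>_. unif)"
  interpret P: prob_space ?P
    by (intro prob_space_PiM prob_space_unif)
  have S': "S \<in> sets (unif \<Otimes>\<^sub>M unif)"
    using S sets_pair_measure_cong[of unif borel unif borel] by simp
  have "P.indep_vars (\<lambda>_. unif) (\<lambda>i x. x i) I"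
    using ij by (intro indep_vars_PiM_coordinates prob_space_unif) auto
  \<comment> \<open>Independence passes to the disjoint blocks \<open>{i}\<close> and
    \<open>{j}\<close>; projecting each block to its only coordinate gives the pair.\<close>
  then have "P.indep_var (PiM {i} (\<lambda>_. unif)) (\<lambda>x. restrict (\<lambda>i. x i) {i})
      (PiM {j} (\<lambda>_. unif)) (\<lambda>x. restrict (\<lambda>i. x i) {j})"
    by (rule P.indep_var_restrict) (use ij in auto)
  then have "P.indep_var unif ((\<lambda>f. f i) \<circ> (\<lambda>x. restrict (\<lambda>i. x i) {i}))
      unif ((\<lambda>f. f j) \<circ> (\<lambda>x. restrict (\<lambda>i. x i) {j}))"
    by (rule P.indep_var_compose) auto
  then have "P.indep_var unif (\<lambda>x. x i) unif (\<lambda>x. x j)"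
    by (simp add: comp_def)
  then have "distr ?P unif (\<lambda>x. x i) \<Otimes>\<^sub>M distr ?P unif (\<lambda>x. x j) =
      distr ?P (unif \<Otimes>\<^sub>M unif) (\<lambda>x. (x i, x j))"
    by (simp add: P.indep_var_distribution_eq)
  then have law: "distr ?P (unif \<Otimes>\<^sub>M unif) (\<lambda>x. (x i, x j)) = unif \<Otimes>\<^sub>M unif"
    using ij by (simp add: distr_PiM_component[OF prob_space_unif])
  have "emeasure ?P {u \<in> space ?P. (u i, u j) \<in> S} =
      emeasure (distr ?P (unif \<Otimes>\<^sub>M unif) (\<lambda>x. (x i, x j))) S"
    using ij S' by (subst emeasure_distr)
      (auto intro!: arg_cong2[where f = emeasure] measurable_component_singleton)
  also have "\<dots> = (\<integral>\<^sup>+x. emeasure unif (Pair x -` S) \<partial>unif)"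
    unfolding law by (rule unif.emeasure_pair_measure_alt[OF S'])
  also have "\<dots> \<le> (\<integral>\<^sup>+x. c \<partial>unif)"
    by (intro nn_integral_mono_AE eventually_mono[OF AE_unif]) (simp add: le)
  also have "\<dots> = c"
    by (simp add: unif.emeasure_space_1[simplified])
  finally show ?thesis .
qed

text \<open>Slices of the diagonal are single points, hence null, and there are finitely many pairs.
  Distinct values are what makes the ranks a permutation.\<close>

lemma AE_PiM_unif_inj_on:
  assumes "finite I"
  shows "AE u in PiM I (\<lambda>_. unif). inj_on u I"
proof -
  let ?P = "PiM I (\<lambda>_. unif)"
  have "AE u in ?P. u i \<noteq> u j" if ij: "i \<in> I" "j \<in> I" "i \<noteq> j" for i j
  proof -
    have "emeasure ?P {u \<in> space ?P. (u i, u j) \<in> {p. fst p = snd p}} \<le> 0"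
    proof (rule emeasure_PiM_unif_pair_le[OF ij])
      have "{p \<in> space (borel \<Otimes>\<^sub>M borel). fst p = (snd p :: real)} \<in> sets (borel \<Otimes>\<^sub>M borel)"
        by measurable
      then show "{p. fst p = (snd p :: real)} \<in> sets (borel \<Otimes>\<^sub>M borel)"
        by (simp add: space_pair_measure)
      fix x :: real
      have "Pair x -` {p. fst p = snd p} = {x}"
        by auto
      moreover have "emeasure lborel ({0<..<1} \<inter> {x}) \<le> emeasure lborel {x}"
        by (rule emeasure_mono) auto
      ultimately show "emeasure unif (Pair x -` {p. fst p = snd p}) \<le> 0"
        by (simp add: emeasure_unif)
    qed
    then show ?thesis
      using ij by (intro AE_I[where N = "{u \<in> space ?P. u i = u j}"])
        (auto simp: borel_measurable_eq)
  qed
  then have "AE u in ?P. \<forall>p\<in>{p \<in> I \<times> I. fst p \<noteq> snd p}. u (fst p) \<noteq> u (snd p)"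
    using assms by (subst AE_finite_all) (auto intro: finite_subset[of _ "I \<times> I"])
  then show ?thesis
    by (rule eventually_mono) (fastforce simp: inj_on_def)
qed

text \<open>Exchangeability of an i.i.d. family, the source of the uniformity of its ranks.\<close>

lemma PiM_unif_reindex:
  assumes "\<sigma> permutes I"
  shows "distr (PiM I (\<lambda>_. unif)) (PiM I (\<lambda>_. unif)) (\<lambda>u. \<lambda>i\<in>I. u (\<sigma> i)) = PiM I (\<lambda>_. unif)"
  using distr_PiM_reindex[of I "\<lambda>_. unif" \<sigma> I] assms
  by (simp add: prob_space_unif permutes_inj_on permutes_in_image)

section \<open>The law of the powers of the row maxima\<close>

text \<open>The maximum is attained by an entry of the row, and powers are monotone on positive
  numbers. The right-hand side describes a box, whose product measure factors.\<close>

lemma unfair_max_power_le_iff: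
  assumes "i \<ge> 1" and "\<And>j. j \<in> {1..i} \<Longrightarrow> x (i, j) > 0"
  shows "unfair_max x i ^ i \<le> t \<longleftrightarrow> (\<forall>j\<in>{1..i}. x (i, j) ^ i \<le> t)"
proof -
  have ne: "(\<lambda>j. x (i, j)) ` {1..i} \<noteq> {}"
    using assms by auto
  have "unfair_max x i \<in> (\<lambda>j. x (i, j)) ` {1..i}"
    unfolding unfair_max_def using ne by (intro Max_in) auto
  then obtain j where "j \<in> {1..i}" "unfair_max x i = x (i, j)"
    by blast
  moreover have "x (i, j) ^ i \<le> unfair_max x i ^ i" if "j \<in> {1..i}" for j
    unfolding unfair_max_def using that assms(2)[OF that] by (intro power_mono Max_ge) auto
  ultimately show ?thesis
    by (metis order_trans)
qed

text \<open>Each of the \<open>i\<close> entries of a row contributes one such factor; for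
  \<open>t\<close> in (0,1) the factor equals \<open>root i t\<close>.\<close>

lemma emeasure_unif_power_le:
  assumes "i \<ge> 1"
  shows "emeasure unif {y. y ^ i \<le> t} ^ i = emeasure unif {..t}"
proof -
  have m: "{y. y ^ i \<le> t} \<in> sets borel"
    by measurable
  consider "t \<le> 0" | "0 < t" "t < 1" | "t \<ge> 1" by linarith
  then show ?thesis
  proof cases
    case 1
    then have "\<not> y ^ i \<le> t" if "0 < y" for y
      using zero_less_power[OF that, of i] by linarith
    then have "{0<..<1} \<inter> {y. y ^ i \<le> t} = {}" "{0<..<1} \<inter> {..t} = {}"
      using 1 by auto
    then show ?thesis
      using assms m by (simp add: emeasure_unif)
  next
    case 2
    have "y ^ i \<le> t \<longleftrightarrow> y \<le> root i t" if "0 < y" for y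
      using that assms real_root_le_iff[of i "y ^ i" t] by (simp add: real_root_power_cancel)
    moreover have "root i t < 1"
      using 2 assms by simp
    ultimately have "{0<..<1} \<inter> {y. y ^ i \<le> t} = {0<..root i t}"
      by auto
    moreover have "{0<..<1} \<inter> {..t} = {0<..t}"
      using 2 by auto
    ultimately show ?thesis
      using assms m 2 by (simp add: emeasure_unif ennreal_power Suc_le_eq)
  next
    case 3
    then have "{0<..<1} \<inter> {y. y ^ i \<le> t} = {0<..<1}" "{0<..<1} \<inter> {..t} = {0<..<1}"
      by (auto intro: order_trans[of _ 1] simp: power_le_one)
    then show ?thesis
      using assms m by (simp add: emeasure_unif)
  qed
qed

lemma measurable_unfair_max_unif [measurable]:
  assumes "i \<in> {1..n}"
  shows "(\<lambda>x. unfair_max x i) \<in> borel_measurable (PiM (unfair_index n) (\<lambda>_. unif))"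
proof -
  have "sets (PiM (unfair_index n) (\<lambda>_. unif)) = sets (PiM (unfair_index n) (\<lambda>_. borel :: real measure))"
    by (rule sets_PiM_cong) simp_all
  then show ?thesis
    using measurable_unfair_max[OF assms] measurable_cong_sets by blast
qed

lemma measurable_unfair_max_power:
  assumes "i \<in> {1..n}"
  shows "(\<lambda>x. unfair_max x i ^ i) \<in> PiM (unfair_index n) (\<lambda>_. unif) \<rightarrow>\<^sub>M unif"
  unfolding measurable_cong_sets[OF refl sets_unif]
  by (intro borel_measurable_power measurable_unfair_max_unif assms)

text \<open>The distribution functions agree: the event that the power is at most \<open>t\<close>
  is almost surely a box over row \<open>i\<close>, so its probability is a product of
  \<open>i\<close> equal factors.\<close>

lemma distr_unfair_max_power:
  assumes i: "i \<in> {1..n}"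
  shows "distr (PiM (unfair_index n) (\<lambda>_. unif)) borel (\<lambda>x. unfair_max x i ^ i) = unif"
proof (rule cdf_unique)
  let ?N = "PiM (unfair_index n) (\<lambda>_. unif)"
  interpret N: prob_space ?N
    by (intro prob_space_PiM prob_space_unif)
  have [measurable]: "(\<lambda>x. unfair_max x i) \<in> borel_measurable ?N"
    by (rule measurable_unfair_max_unif[OF i])
  show "real_distribution (distr ?N borel (\<lambda>x. unfair_max x i ^ i))"
    by (rule N.real_distribution_distr) simp
  show "real_distribution unif"
    by unfold_locales simp_all
  show "cdf (distr ?N borel (\<lambda>x. unfair_max x i ^ i)) = cdf unif"
  proof
    fix t
    have row: "{i} \<times> {1..i} \<subseteq> unfair_index n"
      using i by (auto simp: unfair_index_def)
    have [measurable]: "(\<lambda>x. x p) \<in> borel_measurable ?N" if "p \<in> {i} \<times> {1..i}" for p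
      using measurable_component_singleton[of p "unfair_index n" "\<lambda>_. unif"] that row
      by (auto simp: measurable_cong_sets[OF refl sets_unif])
    have "emeasure ?N {x \<in> space ?N. unfair_max x i ^ i \<le> t} =
        emeasure ?N {x \<in> space ?N. \<forall>p\<in>{i} \<times> {1..i}. x p \<in> {y. y ^ i \<le> t}}"
    \<comment> \<open>The description as a box requires positive entries, which hold almost
      surely.\<close>
    proof (rule emeasure_eq_AE)
      show "AE x in ?N. x \<in> {x \<in> space ?N. unfair_max x i ^ i \<le> t} \<longleftrightarrow>
          x \<in> {x \<in> space ?N. \<forall>p\<in>{i} \<times> {1..i}. x p \<in> {y. y ^ i \<le> t}}"
        using AE_PiM_unif[OF finite_unfair_index]
      proof (rule eventually_mono)
        fix x assume "\<forall>p\<in>unfair_index n. x p \<in> {0<..<1::real}"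
        then have "x (i, j) > 0" if "j \<in> {1..i}" for j
          using row that by force
        then show "x \<in> {x \<in> space ?N. unfair_max x i ^ i \<le> t} \<longleftrightarrow>
          x \<in> {x \<in> space ?N. \<forall>p\<in>{i} \<times> {1..i}. x p \<in> {y. y ^ i \<le> t}}"
          using i unfair_max_power_le_iff[of i x t] by auto
      qed
    qed measurable
    also have "\<dots> = (\<Prod>p\<in>{i} \<times> {1..i}. emeasure unif {y. y ^ i \<le> t})"
      by (rule product_prob_space.emeasure_PiM_Collect[OF product_prob_space_unif row]) auto
    also have "\<dots> = emeasure unif {..t}"
      using i by (simp add: emeasure_unif_power_le card_cartesian_product)
    finally have "measure ?N {x \<in> space ?N. unfair_max x i ^ i \<le> t} = measure unif {..t}"
      by (simp add: measure_def)
    then show "cdf (distr ?N borel (\<lambda>x. unfair_max x i ^ i)) t = cdf unif t"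
      unfolding cdf_def by (subst measure_distr) (auto intro!: arg_cong2[where f = measure] simp: vimage_def Int_def conj_commute)
  qed
qed

text \<open>Rows are disjoint blocks of independent coordinates, so their maxima are independent;
  the uniform marginals then determine the joint law. This is the i.i.d. sequence on which the
  coupling rests.\<close>

lemma distr_unfair_max_powers:
  assumes "n \<ge> 1"
  shows "distr (PiM (unfair_index n) (\<lambda>_. unif)) (PiM {1..n} (\<lambda>_. unif))
    (\<lambda>x. \<lambda>i\<in>{1..n}. unfair_max x i ^ i) = PiM {1..n} (\<lambda>_. unif)"
proof -
  let ?N = "PiM (unfair_index n) (\<lambda>_. unif)"
  let ?K = "\<lambda>i::nat. {i} \<times> {1..i}"
  interpret N: prob_space ?N
    by (intro prob_space_PiM prob_space_unif)
  have row: "?K i \<subseteq> unfair_index n" if "i \<in> {1..n}" for i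
    using that by (auto simp: unfair_index_def)
  have "N.indep_vars (\<lambda>_. unif) (\<lambda>p x. x p) (unfair_index n)"
    using row[of 1] assms by (intro indep_vars_PiM_coordinates prob_space_unif) auto
  then have "N.indep_vars (\<lambda>i. PiM (?K i) (\<lambda>_. unif)) (\<lambda>i x. restrict (\<lambda>p. x p) (?K i)) {1..n}"
    by (rule N.indep_vars_restrict) (use row in \<open>auto simp: disjoint_family_on_def\<close>)
  then have "N.indep_vars (\<lambda>_. unif) (\<lambda>i x. unfair_max (restrict (\<lambda>p. x p) (?K i)) i ^ i) {1..n}"
  proof (rule N.indep_vars_compose2)
    fix i assume "i \<in> {1..n}"
    have "(\<lambda>x. unfair_max x i) \<in> borel_measurable (PiM (?K i) (\<lambda>_. unif))"
      unfolding unfair_max_def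
    proof (rule borel_measurable_Max)
      show "(\<lambda>x. x (i, j)) \<in> borel_measurable (PiM (?K i) (\<lambda>_. unif))" if "j \<in> {1..i}" for j
        using that measurable_component_singleton[of "(i, j)" "?K i" "\<lambda>_. unif"]
        by (simp add: measurable_cong_sets[OF refl sets_unif])
    qed simp
    then have "(\<lambda>x. unfair_max x i ^ i) \<in> borel_measurable (PiM (?K i) (\<lambda>_. unif))"
      by measurable
    then show "(\<lambda>x. unfair_max x i ^ i) \<in> PiM (?K i) (\<lambda>_. unif) \<rightarrow>\<^sub>M unif"
      by (simp add: measurable_cong_sets[OF refl sets_unif])
  qed
  \<comment> \<open>Independence was obtained for functions of the restriction to row
    \<open>i\<close>; the maximum reads only that row.\<close>
  moreover have "unfair_max (restrict (\<lambda>p. x p) (?K i)) i = unfair_max x i" for x i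
    unfolding unfair_max_def by (intro arg_cong[where f = Max] image_cong) auto
  ultimately have ind: "N.indep_vars (\<lambda>_. unif) (\<lambda>i x. unfair_max x i ^ i) {1..n}"
    by simp
  note rv = measurable_unfair_max_power[where n = n]
  have "distr ?N (PiM {1..n} (\<lambda>_. unif)) (\<lambda>x. \<lambda>i\<in>{1..n}. unfair_max x i ^ i) =
      PiM {1..n} (\<lambda>i. distr ?N unif (\<lambda>x. unfair_max x i ^ i))"
    using assms ind rv N.indep_vars_iff_distr_eq_PiM'[where I = "{1..n}" and M' = "\<lambda>_. unif" and X = "\<lambda>i x. unfair_max x i ^ i"]
    by simp
  also have "\<dots> = PiM {1..n} (\<lambda>_. unif)"
  proof (rule PiM_cong)
    fix i assume "i \<in> {1..n}"
    then show "distr ?N unif (\<lambda>x. unfair_max x i ^ i) = unif"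
      using distr_unfair_max_power[of i n] distr_cong[of ?N ?N unif borel] by simp
  qed simp
  finally show ?thesis .
qed

subsection \<open>Ranks\<close>

lemma rank_perm_cong:
  assumes "\<And>i. i \<in> {1..n} \<Longrightarrow> y i = z i"
  shows "rank_perm n y = rank_perm n z"
  using assms by (auto simp: rank_perm_def fun_eq_iff intro!: arg_cong[where f = card])

text \<open>The set counted by the rank grows with the value, and strictly so when
  \<open>z i < z j\<close>, since \<open>j\<close> itself enters. Equal values have equal ranks, so
  ties are covered.\<close>

lemma rank_perm_less_iff:
  assumes "i \<in> {1..n}" "j \<in> {1..n}"
  shows "rank_perm n z i < rank_perm n z j \<longleftrightarrow> z i < z j"
proof (cases "z i < z j")
  case True
  then have "j \<in> {l \<in> {1..n}. z l \<le> z j} - {l \<in> {1..n}. z l \<le> z i}"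
    using assms by auto
  moreover have "{l \<in> {1..n}. z l \<le> z i} \<subseteq> {l \<in> {1..n}. z l \<le> z j}"
    using True by auto
  ultimately have "{l \<in> {1..n}. z l \<le> z i} \<subset> {l \<in> {1..n}. z l \<le> z j}"
    by blast
  then have "card {l \<in> {1..n}. z l \<le> z i} < card {l \<in> {1..n}. z l \<le> z j}"
    by (intro psubset_card_mono) auto
  with True assms show ?thesis
    by (simp add: rank_perm_def)
next
  case False
  then have "card {l \<in> {1..n}. z l \<le> z j} \<le> card {l \<in> {1..n}. z l \<le> z i}"
    by (intro card_mono) auto
  with False assms show ?thesis
    by (simp add: rank_perm_def)
qed

lemma rank_perm_permutes:
  assumes "inj_on z {1..n}"
  shows "rank_perm n z permutes {1..n}"
proof (rule bij_imp_permutes)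
  have inj: "inj_on (rank_perm n z) {1..n}"
  proof (rule inj_onI)
    fix i j assume ij: "i \<in> {1..n}" "j \<in> {1..n}" and "rank_perm n z i = rank_perm n z j"
    then have "z i = z j"
      using rank_perm_less_iff[of i n j z] rank_perm_less_iff[of j n i z] by simp
    with assms ij show "i = j"
      by (blast dest: inj_onD)
  qed
  have "rank_perm n z i \<in> {1..n}" if "i \<in> {1..n}" for i
  proof -
    have "card {l \<in> {1..n}. z l \<le> z i} \<le> card {1..n}"
      by (intro card_mono) auto
    moreover have "card {l \<in> {1..n}. z l \<le> z i} > 0"
      using that by (subst card_gt_0_iff) auto
    ultimately show ?thesis
      using that by (simp add: rank_perm_def)
  qed
  then have "rank_perm n z ` {1..n} \<subseteq> {1..n}"
    by blast
  with inj show "bij_betw (rank_perm n z) {1..n} {1..n}"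
    by (simp add: bij_betw_def endo_inj_surj)
qed (auto simp: rank_perm_def)

text \<open>\<open>\<sigma>\<close> maps the indices counted for \<open>i\<close> on the left
  bijectively onto those counted in the rank of \<open>\<sigma> i\<close>.\<close>

lemma rank_perm_compose:
  assumes "\<sigma> permutes {1..n}"
  shows "rank_perm n (\<lambda>i. z (\<sigma> i)) = rank_perm n z \<circ> \<sigma>"
proof
  fix i
  show "rank_perm n (\<lambda>i. z (\<sigma> i)) i = (rank_perm n z \<circ> \<sigma>) i"
  proof (cases "i \<in> {1..n}")
    case True
    have "\<sigma> ` {l \<in> {1..n}. z (\<sigma> l) \<le> z (\<sigma> i)} = {l \<in> \<sigma> ` {1..n}. z l \<le> z (\<sigma> i)}"
      by blast
    also have "\<dots> = {l \<in> {1..n}. z l \<le> z (\<sigma> i)}"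
      unfolding permutes_image[OF assms] ..
    finally have "\<sigma> ` {l \<in> {1..n}. z (\<sigma> l) \<le> z (\<sigma> i)} = {l \<in> {1..n}. z l \<le> z (\<sigma> i)}" .
    then have "card {l \<in> {1..n}. z l \<le> z (\<sigma> i)} = card {l \<in> {1..n}. z (\<sigma> l) \<le> z (\<sigma> i)}"
      using card_image[OF permutes_inj_on[OF assms, of "{l \<in> {1..n}. z (\<sigma> l) \<le> z (\<sigma> i)}"]]
      by simp
    with True show ?thesis
      using permutes_in_image[OF assms, of i] by (simp add: rank_perm_def)
  next
    case False
    then have "\<sigma> i = i"
      using assms by (simp add: permutes_def)
    with False show ?thesis
      by (auto simp: rank_perm_def)
  qed
qed

section \<open>Expectations of functions of the ranks\<close>

lemma measurable_rank_perm:
  assumes "\<And>i. i \<in> {1..n} \<Longrightarrow> (\<lambda>x. z x i) \<in> borel_measurable M"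
  shows "(\<lambda>x. rank_perm n (z x)) \<in> M \<rightarrow>\<^sub>M count_space UNIV"
proof -
  \<comment> \<open>Writing \<open>z x i\<close> into every entry of row \<open>i\<close> makes the
    row maximum equal to it, so measurability for row maxima carries over to any measurable
    family.\<close>
  define w where "w x = (\<lambda>p\<in>unfair_index n. z x (fst p))" for x
  have "w \<in> M \<rightarrow>\<^sub>M PiM (unfair_index n) (\<lambda>_. borel)"
    unfolding w_def using assms by (intro measurable_restrict) (auto simp: unfair_index_def)
  then have "(\<lambda>x. rank_perm n (unfair_max (w x))) \<in> M \<rightarrow>\<^sub>M count_space UNIV"
    by (rule measurable_compose[OF _ measurable_rank_perm_unfair_max])
  moreover have "rank_perm n (unfair_max (w x)) = rank_perm n (z x)" for x
  proof (rule rank_perm_cong)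
    fix i assume i: "i \<in> {1..n}"
    then have "(\<lambda>j. w x (i, j)) ` {1..i} = {z x i}"
      by (auto simp: w_def unfair_index_def)
    then show "unfair_max (w x) i = z x i"
      by (simp add: unfair_max_def)
  qed
  ultimately show ?thesis
    by simp
qed

lemma measurable_PiM_unif_coordinate [measurable]:
  assumes "i \<in> I"
  shows "(\<lambda>u. u i) \<in> borel_measurable (PiM I (\<lambda>_. unif))"
  using measurable_component_singleton[OF assms, of "\<lambda>_. unif"]
  by (simp add: measurable_cong_sets[OF refl sets_unif])

lemma borel_measurable_rank_perm_unif:
  fixes f :: "(nat \<Rightarrow> nat) \<Rightarrow> real"
  shows "(\<lambda>u. f (rank_perm n u)) \<in> borel_measurable (PiM {1..n} (\<lambda>_. unif))"
    "(\<lambda>u. f (rank_perm n (\<lambda>l. root l (u l)))) \<in> borel_measurable (PiM {1..n} (\<lambda>_. unif))"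
proof -
  have "(\<lambda>u. rank_perm n u) \<in> PiM {1..n} (\<lambda>_. unif) \<rightarrow>\<^sub>M count_space UNIV"
    by (rule measurable_rank_perm) (rule measurable_PiM_unif_coordinate)
  then show "(\<lambda>u. f (rank_perm n u)) \<in> borel_measurable (PiM {1..n} (\<lambda>_. unif))"
    by (rule measurable_compose) simp
  have "(\<lambda>u. rank_perm n (\<lambda>l. root l (u l))) \<in> PiM {1..n} (\<lambda>_. unif) \<rightarrow>\<^sub>M count_space UNIV"
    by (rule measurable_rank_perm)
      (intro measurable_compose[OF _ borel_measurable_root] measurable_PiM_unif_coordinate)
  then show "(\<lambda>u. f (rank_perm n (\<lambda>l. root l (u l)))) \<in> borel_measurable (PiM {1..n} (\<lambda>_. unif))"
    by (rule measurable_compose) simp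
qed

lemma integrable_rank_perm_unif:
  fixes f :: "(nat \<Rightarrow> nat) \<Rightarrow> real"
  assumes "\<And>\<tau>. \<bar>f \<tau>\<bar> \<le> B"
  shows "integrable (PiM {1..n} (\<lambda>_. unif)) (\<lambda>u. f (rank_perm n u))"
    "integrable (PiM {1..n} (\<lambda>_. unif)) (\<lambda>u. f (rank_perm n (\<lambda>l. root l (u l))))"
proof -
  interpret P: prob_space "PiM {1..n} (\<lambda>_. unif)"
    by (intro prob_space_PiM prob_space_unif)
  show "integrable (PiM {1..n} (\<lambda>_. unif)) (\<lambda>u. f (rank_perm n u))"
    "integrable (PiM {1..n} (\<lambda>_. unif)) (\<lambda>u. f (rank_perm n (\<lambda>l. root l (u l))))"
    using assms
    by (intro P.integrable_const_bound[where B = B] borel_measurable_rank_perm_unif AE_I2; simp)+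
qed

text \<open>The ranks of an i.i.d. sequence form a uniform permutation. By exchangeability all
  \<open>n!\<close> integrals obtained by composing with some \<open>\<sigma>\<close> are equal.
  Their sum has an almost surely constant integrand: without ties the rank map is a permutation, and
  composing it with all \<open>\<sigma>\<close> runs through the whole group.\<close>

lemma integral_rank_perm_unif:
  assumes bounded: "\<And>\<tau>. \<bar>f \<tau>\<bar> \<le> (B::real)"
  shows "(\<integral>u. f (rank_perm n u) \<partial>PiM {1..n} (\<lambda>_. unif)) =
    (\<Sum>\<tau> | \<tau> permutes {1..n}. f \<tau>) / fact n"
proof -
  let ?P = "PiM {1..n} (\<lambda>_. unif)" and ?S = "{\<tau>. \<tau> permutes {1..n}}"
  interpret P: prob_space ?P
    by (intro prob_space_PiM prob_space_unif)
  have int: "integrable ?P (\<lambda>u. f (rank_perm n u \<circ> \<sigma>))" for \<sigma>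
    using bounded by (rule integrable_rank_perm_unif(1))
  have "(\<integral>u. f (rank_perm n u \<circ> \<sigma>) \<partial>?P) = (\<integral>u. f (rank_perm n u) \<partial>?P)" if \<sigma>: "\<sigma> \<in> ?S" for \<sigma>
  proof -
    have "(\<integral>u. f (rank_perm n u) \<partial>?P) =
        (\<integral>u. f (rank_perm n u) \<partial>distr ?P ?P (\<lambda>u. \<lambda>i\<in>{1..n}. u (\<sigma> i)))"
      using \<sigma> by (simp add: PiM_unif_reindex)
    also have "\<dots> = (\<integral>u. f (rank_perm n (\<lambda>i\<in>{1..n}. u (\<sigma> i))) \<partial>?P)"
      using \<sigma> permutes_in_image[of \<sigma> "{1..n}"]
      by (intro integral_distr borel_measurable_rank_perm_unif(1) measurable_restrict measurable_component_singleton) blast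
    also have "\<dots> = (\<integral>u. f (rank_perm n u \<circ> \<sigma>) \<partial>?P)"
    proof -
      have "rank_perm n (\<lambda>i\<in>{1..n}. u (\<sigma> i)) = rank_perm n u \<circ> \<sigma>" for u
        using \<sigma> rank_perm_compose[of \<sigma> n u] by (subst rank_perm_cong) auto
      then show ?thesis
        by simp
    qed
    finally show ?thesis
      by simp
  qed
  then have "fact n * (\<integral>u. f (rank_perm n u) \<partial>?P) = (\<Sum>\<sigma>\<in>?S. \<integral>u. f (rank_perm n u \<circ> \<sigma>) \<partial>?P)"
    using card_permutations[of "{1..n}" n] by simp
  also have "\<dots> = (\<integral>u. (\<Sum>\<sigma>\<in>?S. f (rank_perm n u \<circ> \<sigma>)) \<partial>?P)"
    by (rule Bochner_Integration.integral_sum[symmetric]) (rule int)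
  also have "\<dots> = (\<integral>u. (\<Sum>\<tau>\<in>?S. f \<tau>) \<partial>?P)"
  proof (rule integral_cong_AE)
    show "AE u in ?P. (\<Sum>\<sigma>\<in>?S. f (rank_perm n u \<circ> \<sigma>)) = (\<Sum>\<tau>\<in>?S. f \<tau>)"
      using AE_PiM_unif_inj_on[of "{1..n}", OF finite_atLeastAtMost]
      by (rule eventually_mono) (rule setum_permutations_compose_left[OF rank_perm_permutes, symmetric])
    show "(\<lambda>u. \<Sum>\<sigma>\<in>?S. f (rank_perm n u \<circ> \<sigma>)) \<in> borel_measurable ?P"
      by (rule borel_measurable_rank_perm_unif(1)[where f = "\<lambda>\<tau>. \<Sum>\<sigma>\<in>?S. f (\<tau> \<circ> \<sigma>)"])
  qed simp
  finally show ?thesis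
    using P.prob_space by (simp add: field_simps)
qed

lemma integral_uniform_perm:
  fixes f :: "(nat \<Rightarrow> nat) \<Rightarrow> real"
  assumes "\<And>\<tau>. \<bar>f \<tau>\<bar> \<le> B"
  shows "(\<integral>\<tau>. f \<tau> \<partial>uniform_perm n) = (\<integral>u. f (rank_perm n u) \<partial>PiM {1..n} (\<lambda>_. unif))"
proof -
  have "{p. p permutes {1..n}} \<noteq> {}"
    using permutes_id by blast
  moreover have "card {p. p permutes {1..n}} = fact n"
    by (rule card_permutations) auto
  ultimately have "(\<integral>\<tau>. f \<tau> \<partial>uniform_perm n) = (\<Sum>\<tau> | \<tau> permutes {1..n}. f \<tau>) / fact n"
    unfolding uniform_perm_def
    by (simp add: integral_pmf_of_set finite_permutations)
  then show ?thesis
    using integral_rank_perm_unif[of f B n] assms by simp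
qed

text \<open>The maxima are the roots of their own powers, and these powers form an i.i.d. uniform
  sequence.\<close>

lemma integral_inverse_unfair:
  fixes f :: "(nat \<Rightarrow> nat) \<Rightarrow> real"
  assumes "n \<ge> 1"
  shows "(\<integral>\<tau>. f \<tau> \<partial>inverse_unfair n) =
    (\<integral>u. f (rank_perm n (\<lambda>i. root i (u i))) \<partial>PiM {1..n} (\<lambda>_. unif))"
proof -
  let ?N = "PiM (unfair_index n) (\<lambda>_. unif)" and ?P = "PiM {1..n} (\<lambda>_. unif)"
  let ?V = "\<lambda>x. \<lambda>i\<in>{1..n}. unfair_max x i ^ i"
  have meas_rank: "(\<lambda>x. rank_perm n (unfair_max x)) \<in> ?N \<rightarrow>\<^sub>M count_space UNIV"
    by (rule measurable_rank_perm) (rule measurable_unfair_max_unif)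
  note meas_root = borel_measurable_rank_perm_unif(2)[of f n]
  have meas_V: "?V \<in> ?N \<rightarrow>\<^sub>M ?P"
    by (rule measurable_restrict) (rule measurable_unfair_max_power)
  have "(\<integral>\<tau>. f \<tau> \<partial>inverse_unfair n) = (\<integral>x. f (rank_perm n (unfair_max x)) \<partial>?N)"
    unfolding inverse_unfair_def unif_def[symmetric] by (rule integral_distr[OF meas_rank]) simp
  also have "\<dots> = (\<integral>x. f (rank_perm n (\<lambda>i. root i (?V x i))) \<partial>?N)"
  proof (rule integral_cong_AE)
    \<comment> \<open>Taking the root undoes the power because the maxima are almost surely
      positive.\<close>
    show "AE x in ?N. f (rank_perm n (unfair_max x)) = f (rank_perm n (\<lambda>i. root i (?V x i)))"
      using AE_PiM_unif[OF finite_unfair_index]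
    proof (rule eventually_mono)
      fix x assume x: "\<forall>p\<in>unfair_index n. x p \<in> {0<..<1::real}"
      have "unfair_max x i = root i (?V x i)" if i: "i \<in> {1..n}" for i
      proof -
        have "unfair_max x i \<in> (\<lambda>j. x (i, j)) ` {1..i}"
          unfolding unfair_max_def using i by (intro Max_in) auto
        then have "unfair_max x i > 0"
          using x i by (auto simp: unfair_index_def)
        then show ?thesis
          using i by (simp add: real_root_power_cancel)
      qed
      then show "f (rank_perm n (unfair_max x)) = f (rank_perm n (\<lambda>i. root i (?V x i)))"
        by (intro arg_cong[where f = f] rank_perm_cong)
    qed
    show "(\<lambda>x. f (rank_perm n (unfair_max x))) \<in> borel_measurable ?N"
      using meas_rank by (rule measurable_compose) simp
    show "(\<lambda>x. f (rank_perm n (\<lambda>i. root i (?V x i)))) \<in> borel_measurable ?N"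
      by (rule measurable_compose[OF meas_V meas_root])
  qed
  also have "\<dots> = (\<integral>u. f (rank_perm n (\<lambda>i. root i (u i))) \<partial>distr ?N ?P ?V)"
    by (rule integral_distr[symmetric, OF meas_V meas_root])
  also have "\<dots> = (\<integral>u. f (rank_perm n (\<lambda>i. root i (u i))) \<partial>?P)"
    by (simp only: distr_unfair_max_powers[OF assms])
  finally show ?thesis .
qed

subsection \<open>Order changes under the coupling\<close>

text \<open>On (0,1) passing from the \<open>a\<close>-th to the next root does not lower a number,
  so \<open>x < y\<close> always survives. The excluded case is the only way to lose
  \<open>y < x\<close>; it also contains \<open>x = y\<close>, so both orders are strict
  here.\<close>

lemma root_less_iff_of_no_swap:
  fixes x y :: real
  assumes "a \<ge> 1" "0 < x" "x < 1" "0 < y" "y < 1"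
    and no_swap: "\<not> (y \<le> x \<and> root a x \<le> root (Suc a) y)"
  shows "root a x < root (Suc a) y \<longleftrightarrow> x < y" "root (Suc a) y < root a x \<longleftrightarrow> y < x"
proof -
  have "root a y \<le> root (Suc a) y" "root a x \<le> root (Suc a) x"
    using assms by (auto intro: real_root_increasing)
  moreover have "x < y \<Longrightarrow> root a x < root a y"
    using assms by simp
  ultimately have "x < y \<and> root a x < root (Suc a) y \<or> y < x \<and> root (Suc a) y < root a x"
    using no_swap by (cases x y rule: linorder_cases) auto
  then show "root a x < root (Suc a) y \<longleftrightarrow> x < y" "root (Suc a) y < root a x \<longleftrightarrow> y < x"
    by auto
qed

text \<open>\<open>z ^ a\<close> is the smallest of the \<open>a + 1\<close> terms of the geometric
  sum, and \<open>1 - z\<close> times that sum is at most 1.\<close>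

lemma power_diff_power_Suc_le:
  assumes "0 \<le> z" "z \<le> (1::real)"
  shows "z ^ a - z ^ Suc a \<le> 1 / real (Suc a)"
proof -
  have "z ^ a \<le> z ^ i" if "i \<le> a" for i
    using that assms by (rule power_decreasing)
  then have "(\<Sum>i\<le>a. z ^ a) \<le> (\<Sum>i\<le>a. z ^ i)"
    by (intro sum_mono) auto
  then have "(1 - z) * (real (Suc a) * z ^ a) \<le> (1 - z) * (\<Sum>i\<le>a. z ^ i)"
    using assms by (intro mult_left_mono) auto
  also have "\<dots> = 1 - z ^ Suc a"
    by (rule sum_gp_basic)
  also have "\<dots> \<le> 1"
    using assms by simp
  finally show ?thesis
    by (simp add: field_simps)
qed

text \<open>With \<open>z = root a x\<close> the two conditions confine \<open>y\<close> to the
  interval from \<open>z ^ Suc a\<close> to \<open>z ^ a\<close>, whose length has just been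
  bounded.\<close>

lemma emeasure_unif_swap_slice_le:
  assumes "a \<ge> 1" "0 < x" "x < 1" and meas: "{y. y \<le> x \<and> root a x \<le> root (Suc a) y} \<in> sets borel"
  shows "emeasure unif {y. y \<le> x \<and> root a x \<le> root (Suc a) y} \<le> ennreal (1 / real (Suc a))"
proof -
  define z where "z = root a x"
  have z: "0 \<le> z" "z \<le> 1" "z ^ a = x"
    using assms by (auto simp: z_def)
  have le: "z ^ Suc a \<le> z ^ a"
    using z by (intro power_decreasing) auto
  have "z ^ Suc a \<le> y" if "0 < y" "z \<le> root (Suc a) y" for y
    using power_mono[OF that(2) z(1), of "Suc a"] that(1) real_root_pow_pos2[of "Suc a" y] by simp
  then have "{0<..<1} \<inter> {y. y \<le> x \<and> z \<le> root (Suc a) y} \<subseteq> {z ^ Suc a..z ^ a}"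
    using z by auto
  then have "emeasure unif {y. y \<le> x \<and> root a x \<le> root (Suc a) y} \<le> emeasure lborel {z ^ Suc a..z ^ a}"
    using meas by (simp add: emeasure_unif z_def del: emeasure_lborel_Icc) (rule emeasure_mono, auto)
  also have "\<dots> \<le> ennreal (1 / real (Suc a))"
    using le power_diff_power_Suc_le[OF z(1,2), of a] by (simp add: ennreal_leI del: power_Suc)
  finally show ?thesis .
qed

text \<open>Non-strict inequalities put ties into the event, so for coordinates in (0,1) the two
  sequences order \<open>a\<close> and \<open>Suc a\<close> strictly and alike outside it.\<close>

definition swap_event :: "nat \<Rightarrow> nat \<Rightarrow> (nat \<Rightarrow> real) set" where
  "swap_event n a = {u \<in> space (PiM {1..n} (\<lambda>_. unif)).
     u (Suc a) \<le> u a \<and> root a (u a) \<le> root (Suc a) (u (Suc a))}"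

lemma sets_swap_event:
  assumes "1 \<le> a" "Suc a \<le> n"
  shows "swap_event n a \<in> sets (PiM {1..n} (\<lambda>_. unif))"
proof -
  let ?P = "PiM {1..n} (\<lambda>_. unif)"
  have coord: "(\<lambda>u. u a) \<in> borel_measurable ?P" "(\<lambda>u. u (Suc a)) \<in> borel_measurable ?P"
    using assms by (auto intro!: measurable_PiM_unif_coordinate)
  then show ?thesis
    unfolding swap_event_def by (intro sets.sets_Collect_conj borel_measurable_le
        measurable_compose[OF _ borel_measurable_root])
qed

lemma measure_swap_event_le:
  assumes "1 \<le> a" "Suc a \<le> n"
  shows "measure (PiM {1..n} (\<lambda>_. unif)) (swap_event n a) \<le> 1 / real (Suc a)"
proof -
  let ?P = "PiM {1..n} (\<lambda>_. unif)"
  let ?S = "{p. snd p \<le> fst p \<and> root a (fst p) \<le> root (Suc a) (snd p)}"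
  interpret P: prob_space ?P
    by (intro prob_space_PiM prob_space_unif)
  have "{p \<in> space (borel \<Otimes>\<^sub>M borel). snd p \<le> fst p \<and> root a (fst p) \<le> root (Suc a) (snd p)}
      \<in> sets (borel \<Otimes>\<^sub>M borel)"
    by (intro sets.sets_Collect_conj borel_measurable_le measurable_fst measurable_snd
        measurable_compose[OF _ borel_measurable_root])
  then have S: "?S \<in> sets (borel \<Otimes>\<^sub>M borel)"
    by (simp add: space_pair_measure)
  have "emeasure ?P {u \<in> space ?P. (u a, u (Suc a)) \<in> ?S} \<le> ennreal (1 / real (Suc a))"
  proof (rule emeasure_PiM_unif_pair_le[OF _ _ _ S])
    fix x :: real assume "0 < x" "x < 1"
    then show "emeasure unif (Pair x -` ?S) \<le> ennreal (1 / real (Suc a))"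
      using emeasure_unif_swap_slice_le[of a x] sets_Pair1[OF S, of x] assms(1)
      by (simp add: vimage_def)
  qed (use assms in auto)
  then show ?thesis
    unfolding swap_event_def P.emeasure_eq_measure by simp
qed

subsection \<open>Comparison of moments\<close>

locale bounded_windows =
  fixes K :: nat and r1 r2 :: "nat \<Rightarrow> int" and tri :: "nat \<Rightarrow> int \<Rightarrow> nat \<Rightarrow> nat \<Rightarrow> bool"
  assumes r1_le: "i \<ge> 1 \<Longrightarrow> r1 i \<le> int K"
    and r2_le: "i \<ge> 1 \<Longrightarrow> r2 i \<le> int K"
    and tri_cases: "i \<ge> 1 \<Longrightarrow> - r2 i \<le> j \<Longrightarrow> j \<le> r1 i - 1 \<Longrightarrow> tri i j = (<) \<or> tri i j = (>)"
begin

definition window :: "nat \<Rightarrow> nat \<Rightarrow> int set" where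
  "window n i = {- m2 r2 n i .. m1 r1 n i - 1}"

text \<open>Cutting the windows off at 1 and \<open>n\<close> keeps both compared positions inside
  \<open>{1..n}\<close>, so the conversions by \<open>nat\<close> lose nothing.\<close>

lemma window_bounds:
  assumes "i \<in> {1..n}" "j \<in> window n i"
  shows "- int K \<le> j" "j < int K" "1 \<le> nat (int i + j)" "Suc (nat (int i + j)) \<le> n"
    "nat (int i + j + 1) = Suc (nat (int i + j))" "tri i j = (<) \<or> tri i j = (>)"
  using assms r1_le[of i] r2_le[of i] tri_cases[of i j] by (auto simp: window_def m1_def m2_def)

lemma finite_window [simp]: "finite (window n i)"
  by (simp add: window_def)

lemma card_window_le:
  assumes "i \<in> {1..n}"
  shows "card (window n i) \<le> 2 * K"
proof -
  have "window n i \<subseteq> {- int K ..< int K}"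
    using window_bounds(1,2)[OF assms] by auto
  then have "card (window n i) \<le> card {- int K ..< int K}"
    by (intro card_mono) auto
  then show ?thesis
    by simp
qed

text \<open>Ranks compare as the values do, so the pattern can be read off the sequence itself, be
  it the uniform variables or their roots.\<close>

lemma chi_rank_perm:
  assumes "i \<in> {1..n}"
  shows "chi r1 r2 tri n i (rank_perm n z) = of_bool (\<forall>j\<in>window n i.
    if tri i j = (<) then z (nat (int i + j)) < z (Suc (nat (int i + j)))
    else z (Suc (nat (int i + j))) < z (nat (int i + j)))"
proof -
  have "tri i j (rank_perm n z (nat (int i + j))) (rank_perm n z (nat (int i + j + 1))) =
    (if tri i j = (<) then z (nat (int i + j)) < z (Suc (nat (int i + j)))
     else z (Suc (nat (int i + j))) < z (nat (int i + j)))" if "j \<in> window n i" for j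
    using window_bounds(3-6)[OF assms that] by (auto simp: rank_perm_less_iff)
  then show ?thesis
    unfolding chi_def window_def[symmetric] by simp
qed

lemma chi_bounds: "0 \<le> chi r1 r2 tri n i \<tau>" "chi r1 r2 tri n i \<tau> \<le> 1"
  by (simp_all add: chi_def)

lemma Y_bounds: "0 \<le> Y r1 r2 tri n \<tau>" "Y r1 r2 tri n \<tau> \<le> real n"
  using sum_bounded_above[of "{1..n}" "\<lambda>i. chi r1 r2 tri n i \<tau>" 1]
  by (auto simp: Y_def chi_bounds intro!: sum_nonneg)

section \<open>The effect of the coupling on the pattern counts\<close>

text \<open>Indicators differ by at most 1, so a single swap event in the window pays for any
  difference; if none occurs, every comparison has the same outcome.\<close>

lemma chi_root_diff_le:
  assumes i: "i \<in> {1..n}" and u: "u \<in> space (PiM {1..n} (\<lambda>_. unif))" "\<forall>l\<in>{1..n}. u l \<in> {0<..<1}"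
  shows "\<bar>chi r1 r2 tri n i (rank_perm n (\<lambda>l. root l (u l))) - chi r1 r2 tri n i (rank_perm n u)\<bar>
    \<le> (\<Sum>j\<in>window n i. indicator (swap_event n (nat (int i + j))) u)"
proof (cases "\<exists>j\<in>window n i. u \<in> swap_event n (nat (int i + j))")
  case True
  then obtain j where j: "j \<in> window n i" "u \<in> swap_event n (nat (int i + j))"
    by blast
  have "\<bar>chi r1 r2 tri n i (rank_perm n (\<lambda>l. root l (u l))) - chi r1 r2 tri n i (rank_perm n u)\<bar> \<le> 1"
    by (simp add: chi_def)
  also have "1 = (indicator (swap_event n (nat (int i + j))) u :: real)"
    using j by simp
  also have "\<dots> \<le> (\<Sum>j\<in>window n i. indicator (swap_event n (nat (int i + j))) u)"
    using j by (intro member_le_sum[of j]) auto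
  finally show ?thesis .
next
  case False
  have "(root a (u a) < root (Suc a) (u (Suc a)) \<longleftrightarrow> u a < u (Suc a)) \<and>
      (root (Suc a) (u (Suc a)) < root a (u a) \<longleftrightarrow> u (Suc a) < u a)"
    if j: "j \<in> window n i" and a: "a = nat (int i + j)" for a j
  proof -
    have "1 \<le> a" "Suc a \<le> n"
      using window_bounds(3,4)[OF i j] by (simp_all add: a)
    moreover from this have "u a \<in> {0<..<1}" "u (Suc a) \<in> {0<..<1}"
      using u(2) by auto
    moreover have "\<not> (u (Suc a) \<le> u a \<and> root a (u a) \<le> root (Suc a) (u (Suc a)))"
      using False j u(1) by (auto simp: a swap_event_def)
    ultimately show ?thesis
      using root_less_iff_of_no_swap[of a "u a" "u (Suc a)"] by simp
  qed
  then have "chi r1 r2 tri n i (rank_perm n (\<lambda>l. root l (u l))) = chi r1 r2 tri n i (rank_perm n u)"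
    unfolding chi_rank_perm[OF i] by (intro arg_cong[where f = of_bool] ball_cong) auto
  then show ?thesis
    by (simp add: sum_nonneg)
qed

text \<open>A bound in terms of the centre \<open>i\<close> instead of the position
  \<open>i + j\<close>, so that summing over \<open>i\<close> gives a harmonic number.\<close>

lemma measure_swap_event_window_le:
  assumes "i \<in> {1..n}" "j \<in> window n i"
  shows "measure (PiM {1..n} (\<lambda>_. unif)) (swap_event n (nat (int i + j))) \<le> real (Suc K) / real i"
proof -
  define a where "a = nat (int i + j)"
  have a: "1 \<le> a" "Suc a \<le> n" and "i \<le> a + K"
    using window_bounds(1,3,4)[OF assms] by (auto simp: a_def)
  \<comment> \<open>A crude form of \<open>i \<le> a + K\<close> that turns the shift by
    \<open>K\<close> into a factor \<open>K + 1\<close>.\<close>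
  then have "i \<le> Suc K * Suc a"
    by (simp add: algebra_simps)
  then have "real i \<le> real (Suc K) * real (Suc a)"
    unfolding of_nat_mult[symmetric] by (rule of_nat_mono)
  then have "1 / real (Suc a) \<le> real (Suc K) / real i"
    using assms by (simp add: field_simps del: of_nat_Suc)
  with measure_swap_event_le[OF a] show ?thesis
    by (simp add: a_def)
qed

lemma integrable_Y_power:
  "integrable (PiM {1..n} (\<lambda>_. unif)) (\<lambda>u. Y r1 r2 tri n (rank_perm n u) ^ k)"
  "integrable (PiM {1..n} (\<lambda>_. unif)) (\<lambda>u. Y r1 r2 tri n (rank_perm n (\<lambda>l. root l (u l))) ^ k)"
proof -
  have "\<bar>Y r1 r2 tri n \<tau> ^ k\<bar> \<le> real n ^ k" for \<tau>
    using Y_bounds[of n \<tau>] by (simp add: power_abs power_mono)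
  then show "integrable (PiM {1..n} (\<lambda>_. unif)) (\<lambda>u. Y r1 r2 tri n (rank_perm n u) ^ k)"
    "integrable (PiM {1..n} (\<lambda>_. unif)) (\<lambda>u. Y r1 r2 tri n (rank_perm n (\<lambda>l. root l (u l))) ^ k)"
    by (rule integrable_rank_perm_unif[where f = "\<lambda>\<tau>. Y r1 r2 tri n \<tau> ^ k"])+
qed

lemma integrable_Y_diff:
  "integrable (PiM {1..n} (\<lambda>_. unif))
    (\<lambda>u. \<bar>Y r1 r2 tri n (rank_perm n (\<lambda>l. root l (u l))) - Y r1 r2 tri n (rank_perm n u)\<bar>)"
  using integrable_Y_power[of n 1] by (intro integrable_abs Bochner_Integration.integrable_diff) simp_all

text \<open>A union bound: each \<open>i\<close> has at most \<open>2 * K\<close> swap events, each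
  of probability at most \<open>(K + 1) / i\<close>.\<close>

lemma expectation_Y_diff_le:
  "(\<integral>u. \<bar>Y r1 r2 tri n (rank_perm n (\<lambda>l. root l (u l))) - Y r1 r2 tri n (rank_perm n u)\<bar>
      \<partial>PiM {1..n} (\<lambda>_. unif)) \<le> real (2 * K * Suc K) * harm n"
proof -
  let ?P = "PiM {1..n} (\<lambda>_. unif)"
  let ?d = "\<lambda>u. \<Sum>i=1..n. \<Sum>j\<in>window n i. indicator (swap_event n (nat (int i + j))) u :: real"
  interpret P: prob_space ?P
    by (intro prob_space_PiM prob_space_unif)
  have int_ind: "integrable ?P (\<lambda>u. indicator (swap_event n (nat (int i + j))) u :: real)"
    if "i \<in> {1..n}" "j \<in> window n i" for i j
    using window_bounds(3,4)[OF that]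
    by (intro integrable_indicator_PiM_unif sets_swap_event)
  have int: "integrable ?P ?d"
    using int_ind by (intro Bochner_Integration.integrable_sum) auto
  have "(\<integral>u. \<bar>Y r1 r2 tri n (rank_perm n (\<lambda>l. root l (u l))) - Y r1 r2 tri n (rank_perm n u)\<bar> \<partial>?P)
      \<le> (\<integral>u. ?d u \<partial>?P)"
  proof (rule integral_mono_AE)
    show "integrable ?P (\<lambda>u. \<bar>Y r1 r2 tri n (rank_perm n (\<lambda>l. root l (u l))) - Y r1 r2 tri n (rank_perm n u)\<bar>)"
      by (rule integrable_Y_diff)
    show "AE u in ?P. \<bar>Y r1 r2 tri n (rank_perm n (\<lambda>l. root l (u l))) - Y r1 r2 tri n (rank_perm n u)\<bar> \<le> ?d u"
      using AE_PiM_unif[of "{1..n}", OF finite_atLeastAtMost] AE_space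
    proof eventually_elim
      case (elim u)
      then show ?case
        unfolding Y_def sum_subtractf[symmetric]
        by (intro order_trans[OF sum_abs] sum_mono chi_root_diff_le) auto
    qed
  qed (rule int)
  also have "\<dots> = (\<Sum>i=1..n. \<Sum>j\<in>window n i. measure ?P (swap_event n (nat (int i + j))))"
  proof -
    have "(\<integral>u. ?d u \<partial>?P) =
        (\<Sum>i=1..n. \<integral>u. (\<Sum>j\<in>window n i. indicator (swap_event n (nat (int i + j))) u) \<partial>?P)"
      using int_ind by (intro Bochner_Integration.integral_sum Bochner_Integration.integrable_sum) auto
    also have "\<dots> = (\<Sum>i=1..n. \<Sum>j\<in>window n i. \<integral>u. indicator (swap_event n (nat (int i + j))) u \<partial>?P)"
      using int_ind by (intro sum.cong refl Bochner_Integration.integral_sum) auto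
    also have "\<dots> = (\<Sum>i=1..n. \<Sum>j\<in>window n i. measure ?P (swap_event n (nat (int i + j))))"
      by (simp add: Int_absorb2 swap_event_def)
    finally show ?thesis .
  qed
  also have "\<dots> \<le> (\<Sum>i=1..n. real (2 * K * Suc K) * inverse (real i))"
  proof (rule sum_mono)
    fix i assume i: "i \<in> {1..n}"
    have "(\<Sum>j\<in>window n i. measure ?P (swap_event n (nat (int i + j)))) \<le>
        real (card (window n i)) * (real (Suc K) / real i)"
      using i by (intro sum_bounded_above measure_swap_event_window_le)
    also have "\<dots> \<le> real (2 * K) * (real (Suc K) / real i)"
      using card_window_le[OF i] by (intro mult_right_mono of_nat_mono) auto
    also have "\<dots> = real (2 * K * Suc K) * inverse (real i)"
      by (simp add: field_simps)
    finally show "(\<Sum>j\<in>window n i. measure ?P (swap_event n (nat (int i + j)))) \<le>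
        real (2 * K * Suc K) * inverse (real i)" .
  qed
  also have "\<dots> = real (2 * K * Suc K) * harm n"
    by (simp add: harm_def sum_distrib_left)
  finally show ?thesis .
qed

lemma moments_diff_le:
  assumes n: "n \<ge> 1"
  shows "\<bar>(\<integral>u. Y r1 r2 tri n (rank_perm n (\<lambda>l. root l (u l))) ^ k \<partial>PiM {1..n} (\<lambda>_. unif)) -
      (\<integral>u. Y r1 r2 tri n (rank_perm n u) ^ k \<partial>PiM {1..n} (\<lambda>_. unif))\<bar>
    \<le> real n ^ k * (real k * (real (2 * K * Suc K) * (harm n / real n)))"
proof -
  let ?P = "PiM {1..n} (\<lambda>_. unif)"
  let ?Z = "\<lambda>u. Y r1 r2 tri n (rank_perm n (\<lambda>l. root l (u l)))" and ?U = "\<lambda>u. Y r1 r2 tri n (rank_perm n u)"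
  note int_pow = integrable_Y_power[of n k] and int_abs = integrable_Y_diff[of n]
  have pointwise: "\<bar>?Z u ^ k - ?U u ^ k\<bar> \<le> real n ^ k * (real k * (\<bar>?Z u - ?U u\<bar> / real n))" for u
  proof -
    \<comment> \<open>Dividing by \<open>n\<close> brings both counts into [0,1], where the
      \<open>k\<close>-th power is Lipschitz with constant \<open>k\<close>.\<close>
    have "norm ((?Z u / real n) ^ k - (?U u / real n) ^ k) \<le> real k * norm (?Z u / real n - ?U u / real n)"
      using n Y_bounds[of n] by (intro norm_power_diff) (auto simp: field_simps)
    then have "\<bar>?Z u ^ k - ?U u ^ k\<bar> / real n ^ k \<le> real k * (\<bar>?Z u - ?U u\<bar> / real n)"
      by (simp add: power_divide flip: diff_divide_distrib)
    then show ?thesis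
      using n by (simp add: field_simps)
  qed
  have "\<bar>(\<integral>u. ?Z u ^ k \<partial>?P) - (\<integral>u. ?U u ^ k \<partial>?P)\<bar> = \<bar>\<integral>u. ?Z u ^ k - ?U u ^ k \<partial>?P\<bar>"
    using int_pow by simp
  also have "\<dots> \<le> (\<integral>u. \<bar>?Z u ^ k - ?U u ^ k\<bar> \<partial>?P)"
    by (rule integral_abs_bound)
  also have "\<dots> \<le> (\<integral>u. real n ^ k * (real k * (\<bar>?Z u - ?U u\<bar> / real n)) \<partial>?P)"
    using int_pow int_abs by (intro integral_mono pointwise) auto
  also have "\<dots> = real n ^ k * (real k * ((\<integral>u. \<bar>?Z u - ?U u\<bar> \<partial>?P) / real n))"
    by simp
  also have "\<dots> \<le> real n ^ k * (real k * ((real (2 * K * Suc K) * harm n) / real n))"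
    by (intro mult_left_mono divide_right_mono expectation_Y_diff_le) auto
  finally show ?thesis
    by simp
qed

section \<open>A lower bound for the moments under the uniform law\<close>

lemma integrable_chi:
  "integrable (PiM {1..n} (\<lambda>_. unif)) (\<lambda>u. chi r1 r2 tri n i (rank_perm n u))"
  using chi_bounds by (intro integrable_rank_perm_unif(1)[where B = 1]) (simp add: abs_le_iff)

text \<open>The bound is free of \<open>n\<close> and \<open>i\<close>: a pattern involves at most
  \<open>2 * K + 1\<close> independent positions, and it is enough to place each in an interval of
  length \<open>1 / (4 * K + 1)\<close>.\<close>

lemma expectation_chi_ge:
  assumes i: "i \<in> {1..n}"
  shows "(\<integral>u. chi r1 r2 tri n i (rank_perm n u) \<partial>PiM {1..n} (\<lambda>_. unif))
    \<ge> (1 / real (4 * K + 1)) ^ (2 * K + 1)"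
proof -
  let ?P = "PiM {1..n} (\<lambda>_. unif)"
  interpret P: prob_space ?P
    by (intro prob_space_PiM prob_space_unif)
  \<comment> \<open>The heights \<open>h\<close> go up and down as the pattern demands and stay in \<open>{-2K..2K}\<close>, so the pattern
    holds whenever each \<open>u l\<close> lies in the cell, out of \<open>4K + 1\<close> equal ones, given by its height.\<close>
  define s where "s j = (if tri i j = (<) then 1 else -1 :: int)" for j
  define h where "h t = (\<Sum>j\<in>{- int K..<t}. s j)" for t
  define W where "W = {l \<in> {1..n}. \<bar>int l - int i\<bar> \<le> int K}"
  define q where "q = real (4 * K + 1)"
  \<comment> \<open>Adding \<open>2 * K\<close> moves the heights to the range from 0 to
    \<open>4 * K\<close>, so the cells lie within the unit interval.\<close>
  define A where "A l = (let m = real_of_int (h (int l - int i) + 2 * int K) in {m / q<..<(m + 1) / q})" for l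
  have q: "q > 0"
    by (simp add: q_def)
  have h_step: "h (j + 1) = h j + s j" if "- int K \<le> j" for j
  proof -
    have "{- int K..<j + 1} = insert j {- int K..<j}"
      using that by auto
    then show ?thesis
      by (simp add: h_def)
  qed
  have h_bound: "\<bar>h t\<bar> \<le> 2 * int K" if "t \<le> int K" for t
  proof -
    have "\<bar>h t\<bar> \<le> (\<Sum>j\<in>{- int K..<t}. \<bar>s j\<bar>)"
      unfolding h_def by (rule sum_abs)
    also have "\<dots> = (\<Sum>j\<in>{- int K..<t}. 1)"
      by (intro sum.cong) (auto simp: s_def)
    also have "\<dots> \<le> 2 * int K"
      using that by simp
    finally show ?thesis .
  qed
  have finW: "finite W"
    by (simp add: W_def)
  have "W \<subseteq> {i - K..i + K}"
    by (auto simp: W_def)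
  then have "card W \<le> card {i - K..i + K}"
    by (intro card_mono) auto
  then have cardW: "card W \<le> 2 * K + 1"
    by simp
  have "emeasure unif (A l) = ennreal (1 / q)" if "l \<in> W" for l
  proof -
    define m where "m = real_of_int (h (int l - int i) + 2 * int K)"
    have "0 \<le> h (int l - int i) + 2 * int K" "h (int l - int i) + 2 * int K + 1 \<le> 4 * int K + 1"
      using that h_bound[of "int l - int i"] by (auto simp: W_def abs_le_iff)
    then have "0 \<le> m" "m + 1 \<le> q"
      unfolding m_def q_def by linarith+
    then have "0 \<le> m / q" "(m + 1) / q \<le> 1" "m / q \<le> (m + 1) / q"
      using q by (auto simp: field_simps)
    then have "{0<..<1} \<inter> A l = {m / q<..<(m + 1) / q}"
      by (auto simp: A_def m_def Let_def)
    then show ?thesis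
      using q \<open>m / q \<le> (m + 1) / q\<close> by (subst emeasure_unif) (auto simp: A_def Let_def add_divide_distrib)
  qed
  then have "emeasure ?P {u \<in> space ?P. \<forall>l\<in>W. u l \<in> A l} = ennreal (1 / q) ^ card W"
    by (subst product_prob_space.emeasure_PiM_Collect[OF product_prob_space_unif])
      (auto simp: W_def A_def Let_def)
  then have box: "measure ?P {u \<in> space ?P. \<forall>l\<in>W. u l \<in> A l} = (1 / q) ^ card W"
    using q by (simp add: measure_def ennreal_power)
  \<comment> \<open>Near 1 and \<open>n\<close> the set \<open>W\<close> is smaller; since
    \<open>1 / q \<le> 1\<close>, fewer factors only raise the product.\<close>
  have "(1 / real (4 * K + 1)) ^ (2 * K + 1) \<le> (1 / q) ^ card W"
    unfolding q_def using cardW by (intro power_decreasing) auto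
  also have "\<dots> = (\<integral>u. indicator {u \<in> space ?P. \<forall>l\<in>W. u l \<in> A l} u \<partial>?P)"
    using box by (simp add: Int_absorb2)
  also have "\<dots> \<le> (\<integral>u. chi r1 r2 tri n i (rank_perm n u) \<partial>?P)"
  proof (rule integral_mono)
    have "{u \<in> space ?P. \<forall>l\<in>W. u l \<in> A l} \<in> sets ?P"
    proof (rule sets.sets_Collect_finite_All[OF _ finW])
      fix l assume "l \<in> W"
      then have "(\<lambda>u. u l) \<in> borel_measurable ?P"
        by (intro measurable_PiM_unif_coordinate) (simp add: W_def)
      then show "{u \<in> space ?P. u l \<in> A l} \<in> sets ?P"
        unfolding A_def Let_def by measurable
    qed
    then show "integrable ?P (\<lambda>u. indicator {u \<in> space ?P. \<forall>l\<in>W. u l \<in> A l} u :: real)"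
      by (rule integrable_indicator_PiM_unif)
    show "integrable ?P (\<lambda>u. chi r1 r2 tri n i (rank_perm n u))"
      by (rule integrable_chi)
    fix u assume "u \<in> space ?P"
    have "chi r1 r2 tri n i (rank_perm n u) = 1" if u: "\<forall>l\<in>W. u l \<in> A l"
    proof -
      have "if tri i j = (<) then u (nat (int i + j)) < u (Suc (nat (int i + j)))
          else u (Suc (nat (int i + j))) < u (nat (int i + j))" if j: "j \<in> window n i" for j
      proof -
        define a where "a = nat (int i + j)"
        note wb = window_bounds[OF i j]
        have a: "int a - int i = j" "int (Suc a) - int i = j + 1"
          using wb(3) by (auto simp: a_def)
        have "a \<in> W" "Suc a \<in> W"
          using wb(1-4) a by (auto simp: W_def simp flip: a_def)
        then have "u a \<in> A a" "u (Suc a) \<in> A (Suc a)"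
          using u by auto
        \<comment> \<open>Consecutive heights differ by exactly 1, so the scaled values lie in
          adjacent open unit intervals, in the order the pattern asks for.\<close>
        then have "h j + 2 * int K < u a * q" "u a * q < h j + 2 * int K + 1"
          "h j + s j + 2 * int K < u (Suc a) * q" "u (Suc a) * q < h j + s j + 2 * int K + 1"
          using q h_step[OF wb(1)] by (auto simp: A_def Let_def a field_simps simp del: of_nat_Suc)
        then have "if tri i j = (<) then u a * q < u (Suc a) * q else u (Suc a) * q < u a * q"
          by (auto simp: s_def)
        then show ?thesis
          using q mult_less_cancel_right_pos[OF q] unfolding a_def by metis
      qed
      then show ?thesis
        by (simp add: chi_rank_perm[OF i])
    qed
    then show "indicator {u \<in> space ?P. \<forall>l\<in>W. u l \<in> A l} u \<le> chi r1 r2 tri n i (rank_perm n u)"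
      by (auto simp: indicator_def chi_bounds)
  qed
  finally show ?thesis .
qed

text \<open>The mean of the count is at least \<open>c * n\<close>. For \<open>x \<ge> 0\<close>
  Bernoulli's inequality puts the tangent \<open>1 - k + k * x\<close> below \<open>x ^ k\<close>;
  taking expectations at \<open>x = Y / (c * n)\<close>, whose mean is at least 1, gives the bound,
  in place of Jensen's inequality.\<close>

lemma moment_ge:
  assumes n: "n \<ge> 1"
  defines "c \<equiv> (1 / real (4 * K + 1)) ^ (2 * K + 1)"
  shows "(\<integral>u. Y r1 r2 tri n (rank_perm n u) ^ k \<partial>PiM {1..n} (\<lambda>_. unif)) \<ge> (c * real n) ^ k"
proof -
  let ?P = "PiM {1..n} (\<lambda>_. unif)" and ?U = "\<lambda>u. Y r1 r2 tri n (rank_perm n u)"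
  interpret P: prob_space ?P
    by (intro prob_space_PiM prob_space_unif)
  have b: "c * real n > 0"
    using n by (simp add: c_def)
  have int: "integrable ?P ?U"
    using integrable_Y_power(1)[of n 1] by simp
  note int_pow = integrable_Y_power(1)[of n k]
  have "c * real n = (\<Sum>i=1..n. c)"
    by simp
  also have "\<dots> \<le> (\<Sum>i=1..n. \<integral>u. chi r1 r2 tri n i (rank_perm n u) \<partial>?P)"
    unfolding c_def by (intro sum_mono expectation_chi_ge)
  also have "\<dots> = (\<integral>u. ?U u \<partial>?P)"
    unfolding Y_def by (rule Bochner_Integration.integral_sum[symmetric]) (rule integrable_chi)
  finally have mean: "1 \<le> (\<integral>u. ?U u / (c * real n) \<partial>?P)"
    using b by simp
  have int_V: "integrable ?P (\<lambda>u. ?U u / (c * real n))"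
    using int by (rule integrable_divide)
  have int_lin: "integrable ?P (\<lambda>u. (1 - real k) + real k * (?U u / (c * real n)))"
    by (intro Bochner_Integration.integrable_add integrable_mult_right int_V P.integrable_const)
  have "1 \<le> (1 - real k) + real k * (\<integral>u. ?U u / (c * real n) \<partial>?P)"
    using mult_left_mono[OF mean, of "real k"] by simp
  also have "\<dots> = (\<integral>u. 1 - real k \<partial>?P) + (\<integral>u. real k * (?U u / (c * real n)) \<partial>?P)"
    using P.prob_space by simp
  also have "\<dots> = (\<integral>u. (1 - real k) + real k * (?U u / (c * real n)) \<partial>?P)"
    by (intro Bochner_Integration.integral_add[symmetric] integrable_mult_right int_V P.integrable_const)
  also have "\<dots> \<le> (\<integral>u. (?U u / (c * real n)) ^ k \<partial>?P)"
  proof (rule integral_mono[OF int_lin])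
    show "integrable ?P (\<lambda>u. (?U u / (c * real n)) ^ k)"
      unfolding power_divide using int_pow by (rule integrable_divide)
    fix u
    have "0 \<le> ?U u / (c * real n)"
      using b Y_bounds(1)[of n "rank_perm n u"] by simp
    then show "(1 - real k) + real k * (?U u / (c * real n)) \<le> (?U u / (c * real n)) ^ k"
      using Bernoulli_inequality[of "?U u / (c * real n) - 1" k] by (simp add: right_diff_distrib)
  qed
  also have "\<dots> = (\<integral>u. ?U u ^ k \<partial>?P) / (c * real n) ^ k"
    by (simp add: power_divide)
  finally show ?thesis
    using b by (simp add: pos_le_divide_eq)
qed

section \<open>Convergence of the ratio of moments\<close>

text \<open>The powers of \<open>n\<close> in the difference of the moments and in the lower bound
  for the denominator cancel, leaving a constant times \<open>harm n / n\<close>.\<close>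

lemma moment_ratio_tendsto:
  "(\<lambda>n. (\<integral>u. Y r1 r2 tri n (rank_perm n (\<lambda>l. root l (u l))) ^ k \<partial>PiM {1..n} (\<lambda>_. unif)) /
        (\<integral>u. Y r1 r2 tri n (rank_perm n u) ^ k \<partial>PiM {1..n} (\<lambda>_. unif))) \<longlonglongrightarrow> 1"
proof -
  define a where "a n = (\<integral>u. Y r1 r2 tri n (rank_perm n (\<lambda>l. root l (u l))) ^ k \<partial>PiM {1..n} (\<lambda>_. unif))" for n
  define b where "b n = (\<integral>u. Y r1 r2 tri n (rank_perm n u) ^ k \<partial>PiM {1..n} (\<lambda>_. unif))" for n
  define c where "c = (1 / real (4 * K + 1)) ^ (2 * K + 1)"
  define C where "C = real k * real (2 * K * Suc K)"
  have c: "c > 0"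
    by (simp add: c_def)
  have bound: "\<bar>a n / b n - 1\<bar> \<le> C / c ^ k * (harm n / real n)" if n: "n \<ge> 1" for n
  proof -
    have b: "(c * real n) ^ k \<le> b n"
      unfolding b_def c_def by (rule moment_ge[OF n])
    moreover have pos: "0 < (c * real n) ^ k"
      using c n by simp
    ultimately have "b n > 0"
      by linarith
    then have "a n / b n - 1 = (a n - b n) / b n"
      by (simp add: field_simps)
    with \<open>b n > 0\<close> have "\<bar>a n / b n - 1\<bar> = \<bar>a n - b n\<bar> / b n"
      by simp
    also have "\<dots> \<le> (real n ^ k * (C * (harm n / real n))) / b n"
      using moments_diff_le[OF n, of k] \<open>b n > 0\<close>
      by (intro divide_right_mono) (auto simp: a_def b_def C_def mult.assoc)
    also have "\<dots> \<le> (real n ^ k * (C * (harm n / real n))) / (c * real n) ^ k"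
      using b pos by (intro divide_left_mono) (auto simp: C_def harm_nonneg intro!: mult_nonneg_nonneg)
    also have "\<dots> = C / c ^ k * (harm n / real n)"
      using n c by (simp add: power_mult_distrib)
    finally show ?thesis .
  qed
  \<comment> \<open>Splitting off \<open>ln n\<close> leaves a bracket that converges to Euler's
    constant, and both \<open>1 / n\<close> and \<open>ln n / n\<close> vanish in the limit.\<close>
  have "(\<lambda>n. (harm n - ln (real n)) * (1 / real n) + ln (real n) / real n) \<longlonglongrightarrow> euler_mascheroni * 0 + 0"
    by (intro tendsto_add tendsto_mult euler_mascheroni_LIMSEQ lim_1_over_n lim_ln_over_n)
  moreover have "(harm n - ln (real n)) * (1 / real n) + ln (real n) / real n = harm n / real n" for n
    by (simp add: diff_divide_distrib)
  ultimately have "(\<lambda>n. harm n / real n) \<longlonglongrightarrow> 0"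
    by simp
  then have "(\<lambda>n. C / c ^ k * (harm n / real n)) \<longlonglongrightarrow> 0"
    by (rule tendsto_mult_right_zero)
  then have "(\<lambda>n. a n / b n - 1) \<longlonglongrightarrow> 0"
  proof (rule Lim_null_comparison[rotated])
    show "\<forall>\<^sub>F n in sequentially. norm (a n / b n - 1) \<le> C / c ^ k * (harm n / real n)"
      using bound by (intro eventually_sequentiallyI[of 1]) simp
  qed
  then show ?thesis
    unfolding a_def b_def by (simp add: LIM_zero_iff)
qed

end

theorem theorem3p2:
  fixes M :: real
    and r1 r2 :: "nat \<Rightarrow> int"
    and tri :: "nat \<Rightarrow> int \<Rightarrow> nat \<Rightarrow> nat \<Rightarrow> bool"
    and P :: "nat \<Rightarrow> 'a measure" and \<rho> :: "nat \<Rightarrow> 'a \<Rightarrow> nat \<Rightarrow> nat"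
    and Q :: "nat \<Rightarrow> 'b measure" and \<pi> :: "nat \<Rightarrow> 'b \<Rightarrow> nat \<Rightarrow> nat"
    and k :: nat
  assumes r1: "\<And>i. i \<ge> 1 \<Longrightarrow> 1 \<le> r1 i \<and> real_of_int (r1 i) \<le> M"
    and r2: "\<And>i. i \<ge> 1 \<Longrightarrow> 1 \<le> r2 i \<and> real_of_int (r2 i) \<le> M"
    and tri: "\<And>i j. i \<ge> 1 \<Longrightarrow> - r2 i \<le> j \<Longrightarrow> j \<le> r1 i - 1 \<Longrightarrow> tri i j \<in> {(<), (>)}"
    and P: "\<And>n. n \<ge> 1 \<Longrightarrow> prob_space (P n)"
    and Q: "\<And>n. n \<ge> 1 \<Longrightarrow> prob_space (Q n)"
    and rho: "\<And>n. n \<ge> 1 \<Longrightarrow> \<rho> n \<in> P n \<rightarrow>\<^sub>M count_space UNIV"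
    and rho_law: "\<And>n. n \<ge> 1 \<Longrightarrow> distr (P n) (count_space UNIV) (\<rho> n) = inverse_unfair n"
    and pi: "\<And>n. n \<ge> 1 \<Longrightarrow> \<pi> n \<in> Q n \<rightarrow>\<^sub>M count_space UNIV"
    and pi_law: "\<And>n. n \<ge> 1 \<Longrightarrow> distr (Q n) (count_space UNIV) (\<pi> n) = uniform_perm n"
    and k: "k \<ge> 1"
  shows "(\<lambda>n. (\<integral>\<omega>. (Y r1 r2 tri n (\<rho> n \<omega>)) ^ k \<partial>P n) /
              (\<integral>\<omega>. (Y r1 r2 tri n (\<pi> n \<omega>)) ^ k \<partial>Q n)) \<longlonglongrightarrow> 1"
proof -
  \<comment> \<open>Rounding \<open>M\<close> up keeps it a bound for the integers
    \<open>r1 i\<close> and \<open>r2 i\<close>.\<close>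
  interpret bounded_windows "nat \<lceil>M\<rceil>" r1 r2 tri
  proof
    fix i :: nat assume i: "i \<ge> 1"
    then show "r1 i \<le> int (nat \<lceil>M\<rceil>)" "r2 i \<le> int (nat \<lceil>M\<rceil>)"
      using r1[OF i] r2[OF i] by linarith+
    show "tri i j = (<) \<or> tri i j = (>)" if "- r2 i \<le> j" "j \<le> r1 i - 1" for j
      using tri[OF i that] by auto
  qed
  \<comment> \<open>The moments depend only on the laws of the permutations, so both can be computed
    on the common space of the coupling.\<close>
  have "(\<integral>\<omega>. Y r1 r2 tri n (\<rho> n \<omega>) ^ k \<partial>P n) =
      (\<integral>u. Y r1 r2 tri n (rank_perm n (\<lambda>l. root l (u l))) ^ k \<partial>PiM {1..n} (\<lambda>_. unif))"
    if n: "n \<ge> 1" for n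
    using integral_distr[OF rho[OF n], of "\<lambda>\<tau>. Y r1 r2 tri n \<tau> ^ k"]
      integral_inverse_unfair[OF n, of "\<lambda>\<tau>. Y r1 r2 tri n \<tau> ^ k"]
    by (simp add: rho_law[OF n])
  moreover have "(\<integral>\<omega>. Y r1 r2 tri n (\<pi> n \<omega>) ^ k \<partial>Q n) =
      (\<integral>u. Y r1 r2 tri n (rank_perm n u) ^ k \<partial>PiM {1..n} (\<lambda>_. unif))"
    if n: "n \<ge> 1" for n
  proof -
    have "\<bar>Y r1 r2 tri n \<tau> ^ k\<bar> \<le> real n ^ k" for \<tau>
      using Y_bounds[of n \<tau>] by (simp add: power_abs power_mono)
    then show ?thesis
      using integral_distr[OF pi[OF n], of "\<lambda>\<tau>. Y r1 r2 tri n \<tau> ^ k"]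
        integral_uniform_perm[of "\<lambda>\<tau>. Y r1 r2 tri n \<tau> ^ k" "real n ^ k" n]
      by (simp add: pi_law[OF n])
  qed
  \<comment> \<open>The ratios are identified for \<open>n \<ge> 1\<close>, which is enough for the
    limit.\<close>
  ultimately show ?thesis
    by (intro Lim_transform_eventually[OF moment_ratio_tendsto[of k]] eventually_sequentiallyI[of 1])
      simp
qed

end
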